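(* Let $X$ be a Banach space such that the closed unit ball of $X^*$ is weak$^*$-sequentially compact, let $D\subset X$ be nonempty and open, and let $f_1,\dots,f_m$, $g_1,\dots,g_k$, $h_1,\dots,h_p\colon D\to\mathbb{R}$ be functions of class $C^{1,1}(D)$. Consider the problem $(P)$ of minimizing $F=(f_1,\dots,f_m)$ with respect to $\mathbb{R}^m_+$ subject to $x\in D$, $H(x)=0$, $G(x)\in Q$, where $H=(h_1,\dots,h_p)$, $G=(g_1,\dots,g_k)$ and $Q=-\mathbb{R}^k_+$. Assume that $\hat x$ is a weak Pareto efficient solution of $(P)$. Then, for every critical direction $d$ of $(P)$ at $\hat x$, there exist $(\mu,\lambda,\beta)\in(\mathbb{R}^m_+\times\mathbb{R}^k_+\times\mathbb{R}^p)\setminus\{0\}$, $L_j\in\partial^2 f_j(\hat x)(d)$ ($j=1,\dots,m$), $M_i\in\partial^2 g_i(\hat x)(d)$ ($i=1,\dots,k$) and $K_l\in\partial^2 h_l(\hat x)(d)$ ($l=1,\dots,p$) such that: (i) $\lambda_i g_i(\hat x)=0$ for $i=1,\dots,k$; (ii) $\displaystyle\sum_{j=1}^m\mu_j f_j'(\hat x)+\sum_{i=1}^k\lambda_i g_i'(\hat x)+\sum_{l=1}^p\beta_l h_l'(\hat x)=0$; (iii) $\displaystyle\sum_{j=1}^m\mu_j\langle L_j,d\rangle+\sum_{i=1}^k\lambda_i\langle M_i,d\rangle+\sum_{l=1}^p\beta_l\langle K_l,d\rangle\ge0$.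
   Context: **Weak Pareto efficiency.** A point $\hat x\in D$ with $H(\hat x)=0$ and $G(\hat x)\in Q$ is a weak Pareto efficient solution of $(P)$ if there is no $x\in D$ with $H(x)=0$, $G(x)\in Q$ and $f_j(x)<f_j(\hat x)$ for all $j=1,\dots,m$. **$C^{1,1}(D)$.** A function $f\colon D\to\mathbb{R}$ is of class $C^{1,1}(D)$ if it is Gâteaux differentiable on $D$ and its Gâteaux derivative $f'\colon D\to X^*$ is locally Lipschitz on $D$. **Second-order subdifferential.** For $f\in C^{1,1}(D)$, $\hat x\in D$, $d\in X$, $\partial^2 f(\hat x)(d):=\partial\langle f'(\cdot),d\rangle(\hat x)\subset X^*$, where $\partial$ is the Clarke subdifferential: for a locally Lipschitz $g\colon D\to\mathbb{R}$, $\partial g(\hat x)=\{x^*\in X^*: \langle x^*,h\rangle\le g^\circ(\hat x;h)\ \forall h\in X\}$ with $g^\circ(\hat x;h)=\limsup_{x\to\hat x,\,t\to0^+}\frac{g(x+th)-g(x)}{t}$. **Critical direction.** $d\in X$ is a critical direction of $(P)$ at $\hat x$ if $\langle f_j'(\hat x),d\rangle\le0$ for all $j=1,\dots,m$, $H'(\hat x)d=0$, and $G'(\hat x)d\in\overline{\mathrm{cone}}(Q-G(\hat x))$, the closure of $\mathrm{cone}(Q-G(\hat x))$, where $\mathrm{cone}(A)=\{\lambda a:\lambda>0,\ a\in A\}$. *)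

theory Defs
  imports "HOL-Analysis.Analysis"
begin

text \<open>
  The dual space \<open>X\<^sup>*\<close> is \<^typ>\<open>'a \<Rightarrow>\<^sub>L real\<close>. Functions on an open set \<open>D\<close> are represented by total
  functions; every notion below that is evaluated at a point of \<open>D\<close> is local, so the values outside
  \<open>D\<close> are irrelevant.
\<close>

text \<open>For scalar-valued operators the strong operator topology is the weak-star topology.\<close>

abbreviation weak_star_topology :: "('a::real_normed_vector \<Rightarrow>\<^sub>L real) topology"
  where "weak_star_topology \<equiv> strong_operator_topology"

lemma limitin_weak_star_topology:
  "limitin weak_star_topology \<phi> l F \<longleftrightarrow> (\<forall>x. ((\<lambda>n. blinfun_apply (\<phi> n) x) \<longlongrightarrow> blinfun_apply l x) F)"
proof -
  have "limitin weak_star_topology \<phi> l F \<longleftrightarrow> ((\<lambda>n. blinfun_apply (\<phi> n)) \<longlongrightarrow> blinfun_apply l) F"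
    unfolding strong_operator_topology_def limitin_def tendsto_def topspace_pullback_topology
      openin_pullback_topology
    by auto
  also have "\<dots> \<longleftrightarrow> (\<forall>x. ((\<lambda>n. blinfun_apply (\<phi> n) x) \<longlongrightarrow> blinfun_apply l x) F)"
    by (simp add: limitin_componentwise flip: limitin_canonical_iff euclidean_product_topology)
  finally show ?thesis .
qed

definition seq_compactin :: "'a topology \<Rightarrow> 'a set \<Rightarrow> bool"
  where "seq_compactin T S \<longleftrightarrow> S \<subseteq> topspace T \<and>
    (\<forall>\<phi>::nat \<Rightarrow> 'a. (\<forall>n. \<phi> n \<in> S) \<longrightarrow>
      (\<exists>l\<in>S. \<exists>r::nat \<Rightarrow> nat. strict_mono r \<and> limitin T (\<phi> \<circ> r) l sequentially))"

definition has_gateaux_derivative ::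
    "('a::real_normed_vector \<Rightarrow> 'b::real_normed_vector) \<Rightarrow> ('a \<Rightarrow>\<^sub>L 'b) \<Rightarrow> 'a \<Rightarrow> bool"
  where "has_gateaux_derivative f L x \<longleftrightarrow>
    (\<forall>h. ((\<lambda>t::real. (f (x + t *\<^sub>R h) - f x) /\<^sub>R t) \<longlongrightarrow> blinfun_apply L h) (at 0))"

definition gateaux_deriv ::
    "('a::real_normed_vector \<Rightarrow> 'b::real_normed_vector) \<Rightarrow> 'a \<Rightarrow> ('a \<Rightarrow>\<^sub>L 'b)"
  where "gateaux_deriv f x = (THE L. has_gateaux_derivative f L x)"

lemma has_gateaux_derivative_unique:
  assumes "has_gateaux_derivative f L x" "has_gateaux_derivative f M x"
  shows "L = M"
  using assms unfolding has_gateaux_derivative_def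
  by (intro blinfun_eqI) (meson tendsto_unique trivial_limit_at)

lemma gateaux_deriv_eqI: "has_gateaux_derivative f L x \<Longrightarrow> gateaux_deriv f x = L"
  unfolding gateaux_deriv_def using has_gateaux_derivative_unique by blast

definition C11_on :: "'a::real_normed_vector set \<Rightarrow> ('a \<Rightarrow> real) \<Rightarrow> bool"
  where "C11_on D f \<longleftrightarrow>
    (\<forall>x\<in>D. \<exists>L. has_gateaux_derivative f L x) \<and>
    (\<forall>x\<in>D. \<exists>u>0. \<exists>L. L-lipschitz_on (cball x u \<inter> D) (gateaux_deriv f))"

text \<open>
  The upper limit is taken in \<^typ>\<open>ereal\<close>, where it always exists; it is finite whenever \<open>g\<close> is
  Lipschitz near \<open>x\<close>. The base point \<open>y\<close> may equal \<open>x\<close>, hence \<^const>\<open>nhds\<close>.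
\<close>

definition clarke_dderiv :: "('a::real_normed_vector \<Rightarrow> real) \<Rightarrow> 'a \<Rightarrow> 'a \<Rightarrow> ereal"
  where "clarke_dderiv g x h =
    Limsup (nhds x \<times>\<^sub>F at_right 0) (\<lambda>(y, t::real). ereal ((g (y + t *\<^sub>R h) - g y) / t))"

definition clarke_subdiff :: "('a::real_normed_vector \<Rightarrow> real) \<Rightarrow> 'a \<Rightarrow> ('a \<Rightarrow>\<^sub>L real) set"
  where "clarke_subdiff g x = {L. \<forall>h. ereal (blinfun_apply L h) \<le> clarke_dderiv g x h}"

definition subdiff2 :: "('a::real_normed_vector \<Rightarrow> real) \<Rightarrow> 'a \<Rightarrow> 'a \<Rightarrow> ('a \<Rightarrow>\<^sub>L real) set"
  where "subdiff2 f x d = clarke_subdiff (\<lambda>y. blinfun_apply (gateaux_deriv f y) d) x"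

definition nonneg_orthant :: "(real ^ 'n) set"
  where "nonneg_orthant = {y. \<forall>i. 0 \<le> y $ i}"

text \<open>Only strictly positive multiples, so this need not be a \<^const>\<open>cone\<close> in the library's sense.\<close>

definition pos_cone :: "'a::real_vector set \<Rightarrow> 'a set"
  where "pos_cone A = {c *\<^sub>R a | c a. c > 0 \<and> a \<in> A}"

text \<open>
  The problem: minimize \<open>F\<close> with respect to the nonnegative orthant
  subject to \<open>x \<in> D\<close>, \<open>H x = 0\<close>, \<open>G x \<in> Q\<close>.
\<close>

definition weak_pareto_efficient ::
    "'a set \<Rightarrow> ('a \<Rightarrow> real ^ 'm) \<Rightarrow> ('a \<Rightarrow> 'y) \<Rightarrow> 'y set \<Rightarrow> ('a \<Rightarrow> 'z::zero) \<Rightarrow> 'a \<Rightarrow> bool"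
  where "weak_pareto_efficient D F G Q H xh \<longleftrightarrow>
    xh \<in> D \<and> H xh = 0 \<and> G xh \<in> Q \<and>
    \<not> (\<exists>x\<in>D. H x = 0 \<and> G x \<in> Q \<and> (\<forall>j. F x $ j < F xh $ j))"

definition critical_direction ::
    "('a::real_normed_vector \<Rightarrow> real ^ 'm) \<Rightarrow> ('a \<Rightarrow> 'y::real_normed_vector) \<Rightarrow> 'y set \<Rightarrow>
     ('a \<Rightarrow> 'z::real_normed_vector) \<Rightarrow> 'a \<Rightarrow> 'a \<Rightarrow> bool"
  where "critical_direction F G Q H xh d \<longleftrightarrow>
    (\<forall>j. blinfun_apply (gateaux_deriv (\<lambda>x. F x $ j) xh) d \<le> 0) \<and>
    blinfun_apply (gateaux_deriv H xh) d = 0 \<and>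
    blinfun_apply (gateaux_deriv G xh) d \<in> closure (pos_cone ((\<lambda>q. q - G xh) ` Q))"

end

theory Submission
  imports Defs
begin

text \<open>
  Move from \<open>xh\<close> along the parabolic arcs \<open>xh + t d + (t\<^sup>2 / 2) w\<close>, where \<open>d\<close> is the critical
  direction and \<open>w\<close> is free. A function \<open>\<phi>\<close> of class \<open>C\<^sup>1\<^sup>,\<^sup>1\<close> changes along such an arc by
  \<open>t \<phi>'(xh) d + (t\<^sup>2 / 2) (A\<^sub>t + \<phi>'(xh) w + o(1))\<close>, where \<open>A\<^sub>t\<close> is the second-order difference
  quotient in the direction \<open>d\<close> and \<open>o(1)\<close> is uniform for bounded \<open>w\<close>
  (\<open>second_quotient_uniform_limit\<close>).

  The quotient \<open>A\<^sub>t\<close> need not converge as \<open>t\<close> tends to 0. By the Cauchy mean value theorem it equals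
  \<open>\<langle>\<phi>'(xh + s d) - \<phi>'(xh), d\<rangle> / s\<close> for some \<open>s\<close> between 0 and \<open>t\<close>. The functionals
  \<open>(\<phi>'(xh + s d) - \<phi>'(xh)) / s\<close> are bounded, so along some sequence they converge weak-star to a
  functional \<open>L\<close>, and \<open>A\<^sub>t\<close> then tends to \<open>\<langle>L, d\<rangle>\<close>. The decisive point is that \<open>L\<close> belongs to the
  second-order subdifferential (\<open>weak_star_limit_in_subdiff2\<close>): a mixed second difference of
  \<open>\<phi>\<close> in the directions \<open>d\<close> and \<open>v\<close> can be read in either order, which replaces the increment of
  \<open>\<phi>'\<close> along \<open>d\<close> evaluated at \<open>v\<close> by an increment of \<open>\<langle>\<phi>'(\<cdot>), d\<rangle>\<close> along \<open>v\<close>. One sequence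
  \<open>t\<^sub>n\<close> serves all the finitely many functions of the problem.

  Suppose that the derivatives of the equality constraints are linearly independent. If some \<open>w\<close>
  made the second-order coefficients negative for all objectives and active inequality constraints
  whose derivative vanishes at \<open>d\<close>, and zero for the equality constraints, then the Brouwer fixed point theorem would
  correct \<open>w\<close> slightly so that the equality constraints hold exactly
  (\<open>equality_constraints_along_second_order_arc\<close>), and the corrected arc would contain a feasible
  point that improves every objective. So this affine system in \<open>w\<close> has no solution, and separating a
  convex set from the origin in a finite-dimensional space (\<open>affine_system_alternative\<close>) gives the
  multipliers. If the derivatives of the equality constraints are linearly dependent, a dependence
  relation, with the right one of its two signs, is a multiplier already.
\<close>

section \<open>First-order estimates for functions of class \<open>C\<^sup>1\<^sup>,\<^sup>1\<close>\<close>

lemma C11_on_line_derivative: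
  assumes "C11_on D f" "x + s *\<^sub>R d \<in> D"
  shows "((\<lambda>s. f (x + s *\<^sub>R d)) has_real_derivative
           blinfun_apply (gateaux_deriv f (x + s *\<^sub>R d)) d) (at s)"
proof -
  obtain L where L: "has_gateaux_derivative f L (x + s *\<^sub>R d)"
    using assms unfolding C11_on_def by blast
  then have "((\<lambda>t. (f (x + s *\<^sub>R d + t *\<^sub>R d) - f (x + s *\<^sub>R d)) /\<^sub>R t) \<longlongrightarrow> blinfun_apply L d) (at 0)"
    unfolding has_gateaux_derivative_def by blast
  then show ?thesis
    using gateaux_deriv_eqI[OF L]
    by (simp add: DERIV_def scaleR_add_left add.assoc divide_inverse mult.commute)
qed

text \<open>
  The mean value theorem on the segment from \<open>v\<close> to \<open>u\<close>, combined with the Lipschitz bound for the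
  derivative. The radius \<open>\<rho>\<close> is kept in the bound because the linearization at \<open>x\<close> is applied to
  points whose distance to each other is much smaller than their distance to \<open>x\<close>.
\<close>
lemma C11_on_first_order_bound:
  assumes "open D" "C11_on D f" "x \<in> D"
  obtains r K where "r > 0" "K \<ge> 0" "cball x r \<subseteq> D"
    "\<And>u. u \<in> cball x r \<Longrightarrow> norm (gateaux_deriv f u - gateaux_deriv f x) \<le> K * norm (u - x)"
    "\<And>\<rho> u v. \<rho> \<le> r \<Longrightarrow> u \<in> cball x \<rho> \<Longrightarrow> v \<in> cball x \<rho> \<Longrightarrow>
       \<bar>f u - f v - blinfun_apply (gateaux_deriv f x) (u - v)\<bar> \<le> K * \<rho> * norm (u - v)"
proof -
  obtain e K where e: "e > 0" and K: "K-lipschitz_on (cball x e \<inter> D) (gateaux_deriv f)"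
    using assms unfolding C11_on_def by blast
  obtain e' where e': "e' > 0" "cball x e' \<subseteq> D"
    using assms open_contains_cball by blast
  define r where "r = min e e'"
  have r: "r > 0" "cball x r \<subseteq> D" "cball x r \<subseteq> cball x e \<inter> D"
    using e e' unfolding r_def by auto
  have K0: "K \<ge> 0" using K lipschitz_on_nonneg by blast
  have lip: "norm (gateaux_deriv f u - gateaux_deriv f x) \<le> K * norm (u - x)"
    if "u \<in> cball x r" for u
    using lipschitz_onD[OF K, of u x] that r e assms(3) by (auto simp: dist_norm subset_iff)
  have bound: "\<bar>f u - f v - blinfun_apply (gateaux_deriv f x) (u - v)\<bar> \<le> K * \<rho> * norm (u - v)"
    if \<rho>: "\<rho> \<le> r" and u: "u \<in> cball x \<rho>" and v: "v \<in> cball x \<rho>" for \<rho> u v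
  proof -
    have seg: "v + s *\<^sub>R (u - v) \<in> cball x \<rho>" if "0 \<le> s" "s \<le> 1" for s
    proof -
      have "v + s *\<^sub>R (u - v) = (1 - s) *\<^sub>R v + s *\<^sub>R u" by (simp add: algebra_simps)
      then show ?thesis
        using convexD[OF convex_cball v u, of "1 - s" s] that by simp
    qed
    have der: "DERIV (\<lambda>s. f (v + s *\<^sub>R (u - v))) s :> blinfun_apply (gateaux_deriv f (v + s *\<^sub>R (u - v))) (u - v)"
      if "0 \<le> s" "s \<le> 1" for s
      by (rule C11_on_line_derivative[OF assms(2)]) (use seg[OF that] \<rho> r(2) in auto)
    obtain s where s: "0 < s" "s < 1"
      and eq: "f (v + 1 *\<^sub>R (u - v)) - f (v + 0 *\<^sub>R (u - v))
        = (1 - 0) * blinfun_apply (gateaux_deriv f (v + s *\<^sub>R (u - v))) (u - v)"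
      using MVT2[of 0 1 "\<lambda>s. f (v + s *\<^sub>R (u - v))", OF _ der] by auto
    define z where "z = v + s *\<^sub>R (u - v)"
    have z: "z \<in> cball x \<rho>" using seg s unfolding z_def by simp
    have "f u - f v - blinfun_apply (gateaux_deriv f x) (u - v)
        = blinfun_apply (gateaux_deriv f z - gateaux_deriv f x) (u - v)"
      using eq by (simp add: z_def blinfun.diff_left)
    also have "\<bar>\<dots>\<bar> \<le> norm (gateaux_deriv f z - gateaux_deriv f x) * norm (u - v)"
      using norm_blinfun real_norm_def by metis
    also have "\<dots> \<le> K * \<rho> * norm (u - v)"
    proof (rule mult_right_mono)
      have "norm (gateaux_deriv f z - gateaux_deriv f x) \<le> K * norm (z - x)"
        using lip z \<rho> by auto
      also have "\<dots> \<le> K * \<rho>"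
        using z K0 by (intro mult_left_mono) (auto simp: dist_norm norm_minus_commute)
      finally show "norm (gateaux_deriv f z - gateaux_deriv f x) \<le> K * \<rho>" .
    qed auto
    finally show ?thesis .
  qed
  show ?thesis by (rule that[OF r(1) K0 r(2) lip bound])
qed

section \<open>Weak-star limits of difference quotients of the derivative\<close>

text \<open>
  Fix \<open>\<sigma> = s n\<close>. The mixed second difference
  \<open>f (x + \<sigma> d + t v) - f (x + t v) - f (x + \<sigma> d) + f x\<close>, divided by \<open>t\<close>, tends to
  \<open>\<langle>f'(x + \<sigma> d) - f'(x), v\<rangle>\<close> as \<open>t\<close> tends to 0. Read as an increment of
  \<open>\<tau> \<mapsto> f (x + t v + \<tau> d) - f (x + \<tau> d)\<close> over \<open>[0, \<sigma>]\<close>, it equals \<open>\<sigma>\<close> times an increment by \<open>t v\<close>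
  of \<open>\<langle>f'(\<cdot>), d\<rangle>\<close> at a point close to \<open>x\<close>, and such increments are what the Clarke directional
  derivative controls.
\<close>
lemma weak_star_limit_in_subdiff2:
  fixes x d :: "'a::real_normed_vector"
  assumes "open D" "C11_on D f" "x \<in> D"
    and s: "\<And>n. s n > 0" "s \<longlonglongrightarrow> 0"
    and L: "\<And>v. (\<lambda>n. blinfun_apply (gateaux_deriv f (x + s n *\<^sub>R d) - gateaux_deriv f x) v / s n)
              \<longlonglongrightarrow> blinfun_apply L v"
  shows "L \<in> subdiff2 f x d"
proof -
  have "ereal (blinfun_apply L v) \<le> clarke_dderiv (\<lambda>y. blinfun_apply (gateaux_deriv f y) d) x v" for v
  proof (rule ccontr)
    define q where "q = (\<lambda>(y, t::real). ereal ((blinfun_apply (gateaux_deriv f (y + t *\<^sub>R v)) d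
        - blinfun_apply (gateaux_deriv f y) d) / t))"
    assume "\<not> ?thesis"
    then have "Limsup (nhds x \<times>\<^sub>F at_right 0) q < ereal (blinfun_apply L v)"
      unfolding clarke_dderiv_def q_def by (simp add: not_le)
    then obtain C where C: "Limsup (nhds x \<times>\<^sub>F at_right 0) q < ereal C" "C < blinfun_apply L v"
      using ereal_dense2 less_ereal.simps(1) by blast
    have "\<forall>\<^sub>F p in nhds x \<times>\<^sub>F at_right 0. q p < ereal C"
      using C(1) Limsup_lessD by blast
    then obtain P P' where P: "eventually P (nhds x)" and P': "eventually P' (at_right (0::real))"
      and PP: "\<And>y t. P y \<Longrightarrow> P' t \<Longrightarrow> q (y, t) < ereal C"
      unfolding eventually_prod_filter by blast
    obtain e where e: "e > 0" "\<And>y. y \<in> ball x e \<Longrightarrow> P y"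
      using P unfolding eventually_nhds_metric by (auto simp: dist_commute)
    obtain b where b: "b > 0" "\<And>t. 0 < t \<Longrightarrow> t < b \<Longrightarrow> P' t"
      using P' unfolding eventually_at_right_field by auto
    obtain e' where e': "e' > 0" "ball x e' \<subseteq> D"
      using assms open_contains_ball by blast
    define \<rho> where "\<rho> = min e e' / 2"
    have \<rho>: "\<rho> > 0" "\<rho> < e" "2 * \<rho> \<le> e'" using e e' unfolding \<rho>_def by auto
    \<comment> \<open>This bound persists in the limit over \<open>\<sigma> = s n\<close> and contradicts the choice of \<open>C\<close>.\<close>
    have quot: "blinfun_apply (gateaux_deriv f (x + \<sigma> *\<^sub>R d) - gateaux_deriv f x) v / \<sigma> \<le> C"
      if \<sigma>: "0 < \<sigma>" "\<sigma> * norm d < \<rho>" for \<sigma>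
    proof -
      have near: "x + \<tau> *\<^sub>R d \<in> ball x \<rho>" if "0 \<le> \<tau>" "\<tau> \<le> \<sigma>" for \<tau>
      proof -
        have "\<tau> * norm d \<le> \<sigma> * norm d" using that by (simp add: mult_right_mono)
        then show ?thesis using that \<sigma> by (simp add: dist_norm)
      qed
      have second: "(f (x + \<sigma> *\<^sub>R d + t *\<^sub>R v) - f (x + t *\<^sub>R v) - (f (x + \<sigma> *\<^sub>R d) - f x)) / t \<le> \<sigma> * C"
        if t: "0 < t" "t < b" "t * norm v < \<rho>" for t
      proof -
        have inD: "x + \<tau> *\<^sub>R d \<in> D" "x + t *\<^sub>R v + \<tau> *\<^sub>R d \<in> D" if "0 \<le> \<tau>" "\<tau> \<le> \<sigma>" for \<tau>
        proof -
          have n: "norm (\<tau> *\<^sub>R d) < \<rho>" using near[OF that] by (simp add: dist_norm)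
          have "norm (t *\<^sub>R v + \<tau> *\<^sub>R d) < 2 * \<rho>"
            using norm_triangle_ineq[of "t *\<^sub>R v" "\<tau> *\<^sub>R d"] n t by simp
          moreover have "x + t *\<^sub>R v + \<tau> *\<^sub>R d = x + (t *\<^sub>R v + \<tau> *\<^sub>R d)" by (simp add: add.assoc)
          ultimately have "x + t *\<^sub>R v + \<tau> *\<^sub>R d \<in> ball x e'" using \<rho>(3) by (simp add: dist_norm norm_minus_commute add.commute)
          moreover have "x + \<tau> *\<^sub>R d \<in> ball x e'" using n \<rho> by (simp add: dist_norm)
          ultimately show "x + \<tau> *\<^sub>R d \<in> D" "x + t *\<^sub>R v + \<tau> *\<^sub>R d \<in> D" using e' by auto
        qed
        let ?\<psi> = "\<lambda>\<tau>. f (x + t *\<^sub>R v + \<tau> *\<^sub>R d) - f (x + \<tau> *\<^sub>R d)"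
        let ?\<psi>' = "\<lambda>\<tau>. blinfun_apply (gateaux_deriv f (x + t *\<^sub>R v + \<tau> *\<^sub>R d)) d
            - blinfun_apply (gateaux_deriv f (x + \<tau> *\<^sub>R d)) d"
        have "DERIV ?\<psi> \<tau> :> ?\<psi>' \<tau>" if "0 \<le> \<tau>" "\<tau> \<le> \<sigma>" for \<tau>
          by (intro DERIV_diff C11_on_line_derivative[OF assms(2)] inD that)
        then obtain \<tau> where \<tau>: "0 < \<tau>" "\<tau> < \<sigma>" and eq: "?\<psi> \<sigma> - ?\<psi> 0 = (\<sigma> - 0) * ?\<psi>' \<tau>"
          using MVT2[of 0 \<sigma> ?\<psi> ?\<psi>'] \<sigma> by blast
        have "q (x + \<tau> *\<^sub>R d, t) < ereal C"
          using near[of \<tau>] \<tau> \<rho> t by (intro PP e b) auto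
        then have "?\<psi>' \<tau> / t < C" by (simp add: q_def add.commute add.left_commute)
        then have "\<sigma> * (?\<psi>' \<tau> / t) \<le> \<sigma> * C" using \<sigma> by (intro mult_left_mono) auto
        moreover have comm: "x + \<sigma> *\<^sub>R d + t *\<^sub>R v = x + t *\<^sub>R v + \<sigma> *\<^sub>R d" by (simp add: algebra_simps)
        have "f (x + \<sigma> *\<^sub>R d + t *\<^sub>R v) - f (x + t *\<^sub>R v) - (f (x + \<sigma> *\<^sub>R d) - f x) = \<sigma> * ?\<psi>' \<tau>"
          unfolding comm using eq by simp
        ultimately show ?thesis by (simp only: times_divide_eq_right)
      qed
      have gat: "((\<lambda>t. (f (y + t *\<^sub>R v) - f y) / t) \<longlongrightarrow> blinfun_apply (gateaux_deriv f y) v) (at_right 0)"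
        if "y \<in> D" for y
        using C11_on_line_derivative[OF assms(2), of y 0 v] that
        by (auto simp: DERIV_def intro: tendsto_mono[OF at_le])
      have sD: "x + \<sigma> *\<^sub>R d \<in> D" using near[of \<sigma>] \<sigma> \<rho> e' by (auto simp: dist_norm)
      have "((\<lambda>t. (f (x + \<sigma> *\<^sub>R d + t *\<^sub>R v) - f (x + \<sigma> *\<^sub>R d)) / t - (f (x + t *\<^sub>R v) - f x) / t)
          \<longlongrightarrow> blinfun_apply (gateaux_deriv f (x + \<sigma> *\<^sub>R d)) v - blinfun_apply (gateaux_deriv f x) v) (at_right 0)"
        by (intro tendsto_diff gat sD assms)
      moreover have "\<forall>\<^sub>F t in at_right 0. (f (x + \<sigma> *\<^sub>R d + t *\<^sub>R v) - f (x + \<sigma> *\<^sub>R d)) / t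
          - (f (x + t *\<^sub>R v) - f x) / t \<le> \<sigma> * C"
      proof -
        have "((\<lambda>t. t * norm v) \<longlongrightarrow> 0 * norm v) (at_right 0)" by (intro tendsto_intros)
        then have "\<forall>\<^sub>F t in at_right 0. t * norm v < \<rho>" using \<rho> by (simp add: order_tendstoD)
        moreover have "\<forall>\<^sub>F t in at_right 0. 0 < t \<and> t < b"
          using b eventually_at_right_field by auto
        ultimately show ?thesis
        proof eventually_elim
          case (elim t)
          then show ?case using second[of t] unfolding diff_divide_distrib by linarith
        qed
      qed
      ultimately have "blinfun_apply (gateaux_deriv f (x + \<sigma> *\<^sub>R d)) v - blinfun_apply (gateaux_deriv f x) v \<le> \<sigma> * C"
        using tendsto_upperbound trivial_limit_at_right_real by blast
      then show ?thesis using \<sigma> by (simp add: blinfun.diff_left field_simps)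
    qed
    have "(\<lambda>n. s n * norm d) \<longlonglongrightarrow> 0 * norm d" by (intro tendsto_intros s)
    then have "\<forall>\<^sub>F n in sequentially. s n * norm d < \<rho>" using \<rho> by (simp add: order_tendstoD)
    then have "\<forall>\<^sub>F n in sequentially.
        blinfun_apply (gateaux_deriv f (x + s n *\<^sub>R d) - gateaux_deriv f x) v / s n \<le> C"
      by eventually_elim (use quot s in auto)
    then have "blinfun_apply L v \<le> C" using L tendsto_upperbound by fastforce
    then show False using C by simp
  qed
  then show ?thesis unfolding subdiff2_def clarke_subdiff_def by blast
qed

section \<open>Second-order difference quotients\<close>

text \<open>
  The second-order coefficient of \<open>f\<close> along the parabolic arc with velocity \<open>d\<close> and acceleration \<open>w\<close>;
  the case \<open>w = 0\<close> is the usual second-order Taylor quotient along the ray in direction \<open>d\<close>.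
\<close>
definition second_quotient ::
    "('a::real_normed_vector \<Rightarrow> real) \<Rightarrow> 'a \<Rightarrow> 'a \<Rightarrow> real \<Rightarrow> 'a \<Rightarrow> real"
  where "second_quotient f x d t w =
    (f (x + t *\<^sub>R d + (t\<^sup>2 / 2) *\<^sub>R w) - f x - t * blinfun_apply (gateaux_deriv f x) d) / (t\<^sup>2 / 2)"

lemma second_quotient_mean_value:
  assumes "C11_on D f" "t > 0" and seg: "\<And>s. 0 \<le> s \<Longrightarrow> s \<le> t \<Longrightarrow> x + s *\<^sub>R d \<in> D"
  obtains s where "0 < s" "s < t"
    "second_quotient f x d t 0 = blinfun_apply (gateaux_deriv f (x + s *\<^sub>R d) - gateaux_deriv f x) d / s"
proof -
  let ?A = "blinfun_apply (gateaux_deriv f x) d"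
  let ?\<phi> = "\<lambda>s. f (x + s *\<^sub>R d) - f x - s * ?A"
  let ?\<phi>' = "\<lambda>s. blinfun_apply (gateaux_deriv f (x + s *\<^sub>R d)) d - ?A"
  have der: "DERIV ?\<phi> s :> ?\<phi>' s" if "0 \<le> s" "s \<le> t" for s
    using DERIV_diff[OF DERIV_diff[OF C11_on_line_derivative[OF assms(1) seg[OF that]] DERIV_const]
        DERIV_cmult_Id[of ?A]]
    by (simp add: mult.commute)
  have der2: "DERIV (\<lambda>s::real. s\<^sup>2 / 2) s :> s" for s
    by (auto intro!: derivative_eq_intros)
  have "\<exists>s. 0 < s \<and> s < t \<and> (?\<phi> t - ?\<phi> 0) * s = (t\<^sup>2 / 2 - 0\<^sup>2 / 2) * ?\<phi>' s"
    using GMVT'[of 0 t ?\<phi> "\<lambda>s. s\<^sup>2 / 2" "\<lambda>s. s" ?\<phi>']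
      DERIV_isCont[OF der] DERIV_isCont[OF der2] der der2 assms(2) by auto
  then obtain s where s: "0 < s" "s < t" "?\<phi> t * s = (t\<^sup>2 / 2) * ?\<phi>' s"
    by auto
  have "?\<phi> t / (t\<^sup>2 / 2) = ?\<phi>' s / s"
    using s assms(2) by (simp add: field_simps)
  then show ?thesis using that[OF s(1,2)] by (simp add: second_quotient_def blinfun.diff_left)
qed

text \<open>
  The intermediate points from the mean value theorem turn the second-order quotients into
  values at \<open>d\<close> of bounded difference quotients of the derivative, from which weak-star sequential
  compactness selects a convergent subsequence.
\<close>
lemma second_quotient_subsequence:
  fixes x d :: "'a::real_normed_vector"
  assumes ball: "seq_compactin weak_star_topology (cball (0 :: 'a \<Rightarrow>\<^sub>L real) 1)"
    and f: "open D" "C11_on D f" "x \<in> D"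
    and t: "\<And>n. t n > 0" "t \<longlonglongrightarrow> 0"
  shows "\<exists>r L. strict_mono r \<and> L \<in> subdiff2 f x d \<and>
    (\<lambda>n. second_quotient f x d (t (r n)) 0) \<longlonglongrightarrow> blinfun_apply L d"
proof -
  obtain \<rho> K where \<rho>: "\<rho> > 0" "K \<ge> 0" "cball x \<rho> \<subseteq> D"
    and lip: "\<And>u. u \<in> cball x \<rho> \<Longrightarrow> norm (gateaux_deriv f u - gateaux_deriv f x) \<le> K * norm (u - x)"
    using C11_on_first_order_bound[OF f] by metis
  have "(\<lambda>n. t n * norm d) \<longlonglongrightarrow> 0 * norm d" by (intro tendsto_intros t)
  then have "\<forall>\<^sub>F n in sequentially. t n * norm d < \<rho>" using \<rho> by (simp add: order_tendstoD)
  then obtain N where N: "\<And>n. n \<ge> N \<Longrightarrow> t n * norm d < \<rho>"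
    unfolding eventually_sequentially by blast
  \<comment> \<open>Dropping the first terms keeps all the segments in the ball where the Lipschitz bound holds.\<close>
  define T where "T n = t (n + N)" for n
  have near: "x + s *\<^sub>R d \<in> cball x \<rho>" if "0 \<le> s" "s \<le> T n" for s n
  proof -
    have "s * norm d \<le> T n * norm d" using that by (simp add: mult_right_mono)
    then show ?thesis using N[of "n + N"] that by (simp add: dist_norm T_def)
  qed
  have "\<forall>n. \<exists>s. 0 < s \<and> s < T n \<and>
    second_quotient f x d (T n) 0 = blinfun_apply (gateaux_deriv f (x + s *\<^sub>R d) - gateaux_deriv f x) d / s"
  proof
    fix n
    show "\<exists>s. 0 < s \<and> s < T n \<and>
      second_quotient f x d (T n) 0 = blinfun_apply (gateaux_deriv f (x + s *\<^sub>R d) - gateaux_deriv f x) d / s"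
      using second_quotient_mean_value[OF f(2), of "T n" x d] t near[of _ n] \<rho>(3)
      unfolding T_def by (metis subsetD)
  qed
  then obtain s where s: "\<And>n. 0 < s n" "\<And>n. s n < T n"
    and sq: "\<And>n. second_quotient f x d (T n) 0
        = blinfun_apply (gateaux_deriv f (x + s n *\<^sub>R d) - gateaux_deriv f x) d / s n"
    by metis
  \<comment> \<open>The summand 1 keeps \<open>C\<close> positive also when \<open>K * norm d = 0\<close>.\<close>
  define C where "C = K * norm d + 1"
  have C: "C > 0" using \<rho> by (simp add: C_def add_nonneg_pos)
  define \<phi> where "\<phi> n = (1 / (C * s n)) *\<^sub>R (gateaux_deriv f (x + s n *\<^sub>R d) - gateaux_deriv f x)" for n
  have "\<phi> n \<in> cball 0 1" for n
  proof -
    have "norm (gateaux_deriv f (x + s n *\<^sub>R d) - gateaux_deriv f x) \<le> K * norm (s n *\<^sub>R d)"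
      using lip[OF near[of "s n" n]] s[of n] by simp
    also have "\<dots> \<le> C * s n" using s(1)[of n] by (simp add: C_def algebra_simps)
    finally show ?thesis using C s(1)[of n] by (simp add: \<phi>_def)
  qed
  then obtain l r where r: "strict_mono r" and l: "limitin weak_star_topology (\<phi> \<circ> r) l sequentially"
    using ball unfolding seq_compactin_def by blast
  have lim: "(\<lambda>n. blinfun_apply (gateaux_deriv f (x + s (r n) *\<^sub>R d) - gateaux_deriv f x) v / s (r n))
              \<longlonglongrightarrow> blinfun_apply (C *\<^sub>R l) v" for v
  proof -
    have "(\<lambda>n. C * blinfun_apply ((\<phi> \<circ> r) n) v) \<longlonglongrightarrow> C * blinfun_apply l v"
      using l unfolding limitin_weak_star_topology by (intro tendsto_mult_left) auto
    then show ?thesis using C by (simp add: \<phi>_def blinfun.scaleR_left)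
  qed
  have "T \<longlonglongrightarrow> 0" unfolding T_def using t(2) LIMSEQ_ignore_initial_segment by blast
  then have "s \<longlonglongrightarrow> 0"
    by (rule tendsto_sandwich[OF _ _ tendsto_const, rotated 2])
       (auto intro!: always_eventually less_imp_le s)
  then have "(\<lambda>n. s (r n)) \<longlonglongrightarrow> 0" using LIMSEQ_subseq_LIMSEQ[OF _ r] by (simp add: o_def)
  then have "C *\<^sub>R l \<in> subdiff2 f x d"
    using weak_star_limit_in_subdiff2[OF f, of "\<lambda>n. s (r n)"] s lim by blast
  moreover have "(\<lambda>n. second_quotient f x d (t (r n + N)) 0) \<longlonglongrightarrow> blinfun_apply (C *\<^sub>R l) d"
    using lim[of d] sq unfolding T_def by simp
  moreover have "strict_mono (\<lambda>n. r n + N)" using r by (simp add: strict_mono_def)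
  ultimately show ?thesis by blast
qed

lemma second_quotient_common_subsequence:
  fixes x d :: "'a::real_normed_vector"
  assumes ball: "seq_compactin weak_star_topology (cball (0 :: 'a \<Rightarrow>\<^sub>L real) 1)"
    and "open D" "x \<in> D"
    and t: "\<And>n. t n > 0" "t \<longlonglongrightarrow> 0"
    and "finite A" "\<And>f. f \<in> A \<Longrightarrow> C11_on D f"
  shows "\<exists>r. strict_mono r \<and> (\<forall>f\<in>A. \<exists>L\<in>subdiff2 f x d.
    (\<lambda>n. second_quotient f x d (t (r n)) 0) \<longlonglongrightarrow> blinfun_apply L d)"
  using assms(6,7)
proof (induction A)
  case empty
  show ?case using strict_mono_id by blast
next
  case (insert f A)
  then obtain r where r: "strict_mono r" and A: "\<forall>f\<in>A. \<exists>L\<in>subdiff2 f x d.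
    (\<lambda>n. second_quotient f x d (t (r n)) 0) \<longlonglongrightarrow> blinfun_apply L d"
    by blast
  have "(\<lambda>n. t (r n)) \<longlonglongrightarrow> 0" using LIMSEQ_subseq_LIMSEQ[OF t(2) r] by (simp add: o_def)
  then obtain r' L where r': "strict_mono r'" and L: "L \<in> subdiff2 f x d"
    "(\<lambda>n. second_quotient f x d (t (r (r' n))) 0) \<longlonglongrightarrow> blinfun_apply L d"
    using second_quotient_subsequence[OF ball \<open>open D\<close> _ \<open>x \<in> D\<close>, of f "\<lambda>n. t (r n)" d] insert t by blast
  have "\<forall>f\<in>A. \<exists>L\<in>subdiff2 f x d.
    (\<lambda>n. second_quotient f x d (t (r (r' n))) 0) \<longlonglongrightarrow> blinfun_apply L d"
    using A LIMSEQ_subseq_LIMSEQ[OF _ r'] by (fastforce simp: o_def)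
  then show ?case using L strict_mono_o[OF r r'] by (intro exI[of _ "r \<circ> r'"]) (auto simp: o_def)
qed

text \<open>
  Changing the acceleration from 0 to \<open>w\<close> moves the end point by \<open>(t\<^sup>2 / 2) w\<close>, and by the
  first-order bound with a radius \<open>\<rho>\<close> of order \<open>t\<close> the derivative at \<open>x\<close> describes the effect on
  \<open>f\<close> up to an error of order \<open>t\<^sup>3\<close>. Uniformity in \<open>w\<close> is what the fixed point argument for the
  equality constraints requires.
\<close>
lemma second_quotient_uniform_limit:
  assumes f: "open D" "C11_on D f" "x \<in> D"
    and t: "\<And>n. t n > 0" "t \<longlonglongrightarrow> 0"
    and a: "(\<lambda>n. second_quotient f x d (t n) 0) \<longlonglongrightarrow> a"
  shows "uniform_limit (cball 0 R) (\<lambda>n. second_quotient f x d (t n))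
           (\<lambda>w. a + blinfun_apply (gateaux_deriv f x) w) sequentially"
proof (rule uniform_limitI)
  fix e :: real assume e: "e > 0"
  obtain r K where r: "r > 0" "K \<ge> 0"
    and bound: "\<And>\<rho> u v. \<rho> \<le> r \<Longrightarrow> u \<in> cball x \<rho> \<Longrightarrow> v \<in> cball x \<rho> \<Longrightarrow>
       \<bar>f u - f v - blinfun_apply (gateaux_deriv f x) (u - v)\<bar> \<le> K * \<rho> * norm (u - v)"
    using C11_on_first_order_bound[OF f] by metis
  define \<rho> where "\<rho> n = t n * norm d + (t n)\<^sup>2 / 2 * \<bar>R\<bar>" for n
  have "\<rho> \<longlonglongrightarrow> 0 * norm d + 0\<^sup>2 / 2 * \<bar>R\<bar>" unfolding \<rho>_def by (intro tendsto_intros t) simp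
  then have \<rho>0: "\<rho> \<longlonglongrightarrow> 0" by simp
  then have "(\<lambda>n. K * \<rho> n * \<bar>R\<bar>) \<longlonglongrightarrow> K * 0 * \<bar>R\<bar>" by (intro tendsto_intros)
  then have "\<forall>\<^sub>F n in sequentially. K * \<rho> n * \<bar>R\<bar> < e / 2" using e by (intro order_tendstoD(2)) auto
  moreover have "\<forall>\<^sub>F n in sequentially. \<rho> n < r" using r \<rho>0 by (simp add: order_tendstoD)
  moreover have "\<forall>\<^sub>F n in sequentially. \<bar>second_quotient f x d (t n) 0 - a\<bar> < e / 2"
    using tendstoD[OF a, of "e/2"] e by (simp add: dist_real_def)
  ultimately show "\<forall>\<^sub>F n in sequentially. \<forall>w\<in>cball 0 R.
      dist (second_quotient f x d (t n) w) (a + blinfun_apply (gateaux_deriv f x) w) < e"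
  proof eventually_elim
    case (elim n)
    show ?case
    proof
      fix w :: 'a assume w: "w \<in> cball 0 R"
      define c where "c = (t n)\<^sup>2 / 2"
      have c: "c > 0" using t(1)[of n] by (simp add: c_def)
      let ?u = "x + t n *\<^sub>R d + c *\<^sub>R w" and ?v = "x + t n *\<^sub>R d"
      have wR: "norm w \<le> \<bar>R\<bar>" using w by simp
      have "norm (t n *\<^sub>R d + c *\<^sub>R w) \<le> t n * norm d + c * norm w"
        using norm_triangle_ineq[of "t n *\<^sub>R d" "c *\<^sub>R w"] t(1)[of n] c by simp
      also have "\<dots> \<le> \<rho> n" using wR c by (simp add: \<rho>_def c_def[symmetric])
      finally have "norm (t n *\<^sub>R d + c *\<^sub>R w) \<le> \<rho> n" .
      moreover have "?u - x = t n *\<^sub>R d + c *\<^sub>R w" by simp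
      ultimately have u: "?u \<in> cball x (\<rho> n)" by (simp only: mem_cball dist_norm norm_minus_commute[of x])
      have v: "?v \<in> cball x (\<rho> n)"
        using t(1)[of n] by (simp add: dist_norm \<rho>_def)
      have "\<bar>f ?u - f ?v - blinfun_apply (gateaux_deriv f x) (?u - ?v)\<bar> \<le> K * \<rho> n * norm (?u - ?v)"
        by (rule bound[OF _ u v]) (use elim(2) in simp)
      then have *: "\<bar>f ?u - f ?v - c * blinfun_apply (gateaux_deriv f x) w\<bar> \<le> c * (K * \<rho> n * norm w)"
        using c by (simp add: blinfun.scaleR_right algebra_simps)
      have "second_quotient f x d (t n) w - second_quotient f x d (t n) 0 - blinfun_apply (gateaux_deriv f x) w
          = (f ?u - f ?v - c * blinfun_apply (gateaux_deriv f x) w) / c"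
        using c by (simp add: second_quotient_def c_def[symmetric] field_simps)
      also have "\<bar>\<dots>\<bar> \<le> K * \<rho> n * norm w"
        using * c by (simp add: abs_divide field_simps)
      also have "\<dots> \<le> K * \<rho> n * \<bar>R\<bar>"
        using wR r t(1)[of n] by (intro mult_left_mono) (auto simp: \<rho>_def)
      also have "\<dots> < e / 2" by (rule elim)
      finally show "dist (second_quotient f x d (t n) w) (a + blinfun_apply (gateaux_deriv f x) w) < e"
        using elim(3) unfolding dist_real_def by linarith
    qed
  qed
qed

lemma C11_on_imp_isCont:
  assumes "open D" "C11_on D f" "x \<in> D"
  shows "isCont f x"
proof -
  obtain r K where r: "r > 0" "K \<ge> 0"
    and bound: "\<And>\<rho> u v. \<rho> \<le> r \<Longrightarrow> u \<in> cball x \<rho> \<Longrightarrow> v \<in> cball x \<rho> \<Longrightarrow>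
       \<bar>f u - f v - blinfun_apply (gateaux_deriv f x) (u - v)\<bar> \<le> K * \<rho> * norm (u - v)"
    using C11_on_first_order_bound[OF assms] by metis
  have "((\<lambda>u. f u - f x - blinfun_apply (gateaux_deriv f x) (u - x)) \<longlongrightarrow> 0) (at x)"
  proof (rule Lim_null_comparison)
    have "\<forall>\<^sub>F u in at x. u \<in> cball x r"
      using r eventually_at_ball[of r x UNIV] by (auto elim!: eventually_mono)
    then show "\<forall>\<^sub>F u in at x. norm (f u - f x - blinfun_apply (gateaux_deriv f x) (u - x))
        \<le> K * r * norm (u - x)"
      by eventually_elim (use bound[of r] r in auto)
    have "((\<lambda>u. K * r * norm (u - x)) \<longlongrightarrow> K * r * norm (x - x)) (at x)" by (intro tendsto_intros)
    then show "((\<lambda>u. K * r * norm (u - x)) \<longlongrightarrow> 0) (at x)" by simp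
  qed
  moreover have "((\<lambda>u. f x + blinfun_apply (gateaux_deriv f x) (u - x))
      \<longlongrightarrow> f x + blinfun_apply (gateaux_deriv f x) (x - x)) (at x)"
    by (intro tendsto_intros)
  ultimately have "((\<lambda>u. (f u - f x - blinfun_apply (gateaux_deriv f x) (u - x)) +
      (f x + blinfun_apply (gateaux_deriv f x) (u - x)))
      \<longlongrightarrow> 0 + (f x + blinfun_apply (gateaux_deriv f x) (x - x))) (at x)"
    by (rule tendsto_add)
  then show ?thesis by (simp add: isCont_def)
qed

section \<open>Behaviour along parabolic arcs\<close>

text \<open>
  The product filter lets the acceleration vary near \<open>w\<close> while \<open>n\<close> grows, so that what is shown about
  arcs remains true for the small correction of \<open>w\<close> that restores the equality constraints.
\<close>
lemma tendsto_second_order_arc: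
  fixes x d w :: "'a::real_normed_vector"
  assumes "t \<longlonglongrightarrow> 0"
  shows "((\<lambda>p. x + t (fst p) *\<^sub>R d + ((t (fst p))\<^sup>2 / 2) *\<^sub>R snd p) \<longlongrightarrow> x) (sequentially \<times>\<^sub>F nhds w)"
proof -
  have 1: "((\<lambda>p. t (fst p)) \<longlongrightarrow> 0) (sequentially \<times>\<^sub>F nhds w)"
    using filterlim_compose[OF assms filterlim_fst] .
  have 2: "((\<lambda>p. snd p) \<longlongrightarrow> w) (sequentially \<times>\<^sub>F nhds w)"
    by (rule filterlim_snd)
  have "((\<lambda>p. x + t (fst p) *\<^sub>R d + ((t (fst p))\<^sup>2 / 2) *\<^sub>R snd p) \<longlongrightarrow> x + 0 *\<^sub>R d + (0\<^sup>2 / 2) *\<^sub>R w)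
     (sequentially \<times>\<^sub>F nhds w)"
    by (intro tendsto_intros 1 2) simp
  then show ?thesis by simp
qed

lemma tendsto_second_quotient:
  assumes f: "open D" "C11_on D f" "x \<in> D"
    and t: "\<And>n. t n > 0" "t \<longlonglongrightarrow> 0"
    and a: "(\<lambda>n. second_quotient f x d (t n) 0) \<longlonglongrightarrow> a"
  shows "((\<lambda>p. second_quotient f x d (t (fst p)) (snd p)) \<longlongrightarrow> a + blinfun_apply (gateaux_deriv f x) w)
           (sequentially \<times>\<^sub>F nhds w)"
proof (rule tendstoI)
  fix e :: real assume e: "e > 0"
  let ?A = "blinfun_apply (gateaux_deriv f x)"
  have "\<forall>\<^sub>F n in sequentially. \<forall>v\<in>cball 0 (norm w + 1). dist (second_quotient f x d (t n) v) (a + ?A v) < e / 2"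
    using uniform_limitD[OF second_quotient_uniform_limit[OF f t a], of "e/2" "norm w + 1"] e by simp
  moreover have "\<forall>\<^sub>F v in nhds w. v \<in> ball w 1 \<and> dist (a + ?A v) (a + ?A w) < e / 2"
  proof (rule eventually_conj)
    show "\<forall>\<^sub>F v in nhds w. v \<in> ball w 1" by (intro eventually_nhds_in_open) auto
    have "((\<lambda>v. a + ?A v) \<longlongrightarrow> a + ?A w) (nhds w)" by (intro tendsto_intros filterlim_ident)
    then show "\<forall>\<^sub>F v in nhds w. dist (a + ?A v) (a + ?A w) < e / 2"
      by (rule tendstoD) (use e in simp)
  qed
  ultimately have "\<forall>\<^sub>F p in sequentially \<times>\<^sub>F nhds w.
      (\<forall>v\<in>cball 0 (norm w + 1). dist (second_quotient f x d (t (fst p)) v) (a + ?A v) < e / 2) \<and>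
      (snd p \<in> ball w 1 \<and> dist (a + ?A (snd p)) (a + ?A w) < e / 2)"
    by (rule eventually_prodI)
  then show "\<forall>\<^sub>F p in sequentially \<times>\<^sub>F nhds w.
      dist (second_quotient f x d (t (fst p)) (snd p)) (a + ?A w) < e"
  proof eventually_elim
    case (elim p)
    then have "norm (snd p) \<le> norm w + 1"
      using norm_triangle_ineq2[of "snd p" w] by (simp add: dist_norm norm_minus_commute)
    then show ?case using elim dist_triangle_half_l[of _ "a + ?A (snd p)" e] by (simp add: dist_commute)
  qed
qed

lemma second_quotient_eq:
  assumes "t \<noteq> 0"
  shows "f (x + t *\<^sub>R d + (t\<^sup>2 / 2) *\<^sub>R w) =
    f x + t * blinfun_apply (gateaux_deriv f x) d + t\<^sup>2 / 2 * second_quotient f x d t w"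
proof -
  define c where "c = t\<^sup>2 / 2"
  have "c \<noteq> 0" using assms by (simp add: c_def)
  then show ?thesis by (simp add: second_quotient_def c_def[symmetric])
qed

text \<open>
  If the first-order coefficient is negative, it dominates the bounded second-order one; if it
  vanishes, the sign of the second-order coefficient decides.
\<close>
lemma descent_along_second_order_arc:
  assumes f: "open D" "C11_on D f" "x \<in> D"
    and t: "\<And>n. t n > 0" "t \<longlonglongrightarrow> 0"
    and a: "(\<lambda>n. second_quotient f x d (t n) 0) \<longlonglongrightarrow> a"
    and le: "blinfun_apply (gateaux_deriv f x) d \<le> 0"
    and second: "blinfun_apply (gateaux_deriv f x) d = 0 \<Longrightarrow> a + blinfun_apply (gateaux_deriv f x) w < 0"
  shows "\<forall>\<^sub>F p in sequentially \<times>\<^sub>F nhds w.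
    f (x + t (fst p) *\<^sub>R d + ((t (fst p))\<^sup>2 / 2) *\<^sub>R snd p) < f x"
proof -
  let ?F = "sequentially \<times>\<^sub>F nhds w"
  let ?A = "blinfun_apply (gateaux_deriv f x)"
  note q = tendsto_second_quotient[OF f t a, of w]
  have eq: "f (x + t (fst p) *\<^sub>R d + ((t (fst p))\<^sup>2 / 2) *\<^sub>R snd p) =
      f x + t (fst p) * (?A d + t (fst p) / 2 * second_quotient f x d (t (fst p)) (snd p))" for p
    using second_quotient_eq[of "t (fst p)" f x d "snd p"] t(1)[of "fst p"]
    by (simp add: algebra_simps power2_eq_square)
  have "\<forall>\<^sub>F p in ?F. ?A d + t (fst p) / 2 * second_quotient f x d (t (fst p)) (snd p) < 0"
  proof (cases "?A d = 0")
    case True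
    have "\<forall>\<^sub>F p in ?F. second_quotient f x d (t (fst p)) (snd p) < 0"
      using order_tendstoD(2)[OF q second[OF True]] .
    then show ?thesis by eventually_elim (use True t(1) in \<open>simp add: mult_pos_neg\<close>)
  next
    case False
    have "((\<lambda>p. ?A d + t (fst p) / 2 * second_quotient f x d (t (fst p)) (snd p))
        \<longlongrightarrow> ?A d + 0 / 2 * (a + ?A w)) ?F"
      by (intro tendsto_intros q filterlim_compose[OF t(2) filterlim_fst]) simp
    then show ?thesis using False le by (intro order_tendstoD(2)) auto
  qed
  then show ?thesis
    unfolding eq by eventually_elim (use t(1) in \<open>simp add: mult_pos_neg\<close>)
qed

text \<open>
  The vectors \<open>e q\<close> are dual to the derivatives, so replacing \<open>w\<close> by \<open>w + \<Sum>\<^sub>q z\<^sub>q e q\<close> turns the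
  vector of second-order quotients into \<open>\<Phi> z = z + o(1)\<close>, uniformly for small \<open>z\<close>. Hence
  \<open>z \<mapsto> z - \<Phi> z\<close> maps a small ball into itself, and its Brouwer fixed point is a zero of \<open>\<Phi>\<close>. The
  predicate \<open>P\<close> collects the other requirements that the corrected arc has to satisfy.
\<close>
lemma equality_constraints_along_second_order_arc:
  fixes h :: "'p::finite \<Rightarrow> 'a::real_normed_vector \<Rightarrow> real"
  assumes h: "open D" "\<And>l. C11_on D (h l)" "x \<in> D"
    and t: "\<And>n. t n > 0" "t \<longlonglongrightarrow> 0"
    and c: "\<And>l. (\<lambda>n. second_quotient (h l) x d (t n) 0) \<longlonglongrightarrow> c l"
    and e: "\<And>l q. blinfun_apply (gateaux_deriv (h l) x) (e q) = (if l = q then 1 else 0)"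
    and zero: "\<And>l. h l x = 0" "\<And>l. blinfun_apply (gateaux_deriv (h l) x) d = 0"
    and w: "\<And>l. c l + blinfun_apply (gateaux_deriv (h l) x) w = 0"
    and P: "\<forall>\<^sub>F p in sequentially \<times>\<^sub>F nhds w. P p"
  shows "\<exists>n v. P (n, v) \<and> (\<forall>l. h l (x + t n *\<^sub>R d + ((t n)\<^sup>2 / 2) *\<^sub>R v) = 0)"
proof -
  define arc where "arc n v = x + t n *\<^sub>R d + ((t n)\<^sup>2 / 2) *\<^sub>R v" for n v
  define E where "E z = (\<Sum>q\<in>UNIV. (z $ q) *\<^sub>R e q)" for z :: "real ^ 'p"
  have "\<forall>\<^sub>F p in sequentially \<times>\<^sub>F nhds w. arc (fst p) (snd p) \<in> D"
    using topological_tendstoD[OF tendsto_second_order_arc[OF t(2), of x d w]] h by (simp add: arc_def)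
  with P have "\<forall>\<^sub>F p in sequentially \<times>\<^sub>F nhds w. P p \<and> arc (fst p) (snd p) \<in> D"
    by (rule eventually_conj)
  then obtain N W where N: "eventually N sequentially" and W: "eventually W (nhds w)"
    and NW: "\<And>n v. N n \<Longrightarrow> W v \<Longrightarrow> P (n, v) \<and> arc n v \<in> D"
    unfolding eventually_prod_filter by auto
  obtain \<delta> where \<delta>: "\<delta> > 0" "\<And>v. dist v w < \<delta> \<Longrightarrow> W v"
    using W unfolding eventually_nhds_metric by auto
  define M where "M = (\<Sum>q\<in>UNIV. norm (e q)) + 1"
  have M: "M > 0" unfolding M_def by (intro add_nonneg_pos sum_nonneg) auto
  have E_le: "norm (E z) \<le> norm z * M" for z
  proof -
    have "norm (E z) \<le> (\<Sum>q\<in>UNIV. norm ((z $ q) *\<^sub>R e q))" unfolding E_def by (rule norm_sum)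
    also have "\<dots> \<le> (\<Sum>q\<in>UNIV. norm z * norm (e q))"
      by (intro sum_mono) (auto intro!: mult_right_mono component_le_norm_cart)
    also have "\<dots> \<le> norm z * M" by (simp add: M_def sum_distrib_left algebra_simps)
    finally show ?thesis .
  qed
  have hE: "blinfun_apply (gateaux_deriv (h l) x) (E z) = z $ l" for l z
    by (simp add: E_def blinfun.sum_right blinfun.scaleR_right e if_distrib cong: if_cong)
  define \<epsilon> where "\<epsilon> = \<delta> / (2 * M)"
  have \<epsilon>: "\<epsilon> > 0" using \<delta> M by (simp add: \<epsilon>_def)
  have \<epsilon>\<delta>: "norm (E z) < \<delta>" if "norm z \<le> \<epsilon>" for z
  proof -
    have "norm (E z) \<le> \<epsilon> * M" using E_le[of z] mult_right_mono[OF that, of M] M by linarith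
    also have "\<dots> < \<delta>" using M \<delta> by (simp add: \<epsilon>_def)
    finally show ?thesis .
  qed
  \<comment> \<open>Componentwise errors below \<open>\<eta>\<close> add up to at most \<open>\<epsilon>\<close> in the sum norm, which bounds the Euclidean one.\<close>
  define \<eta> where "\<eta> = \<epsilon> / CARD('p)"
  have "\<eta> > 0" using \<epsilon> by (simp add: \<eta>_def)
  then have "\<forall>\<^sub>F n in sequentially. \<forall>v\<in>cball 0 (norm w + \<delta>). dist (second_quotient (h l) x d (t n) v)
      (c l + blinfun_apply (gateaux_deriv (h l) x) v) < \<eta>" for l
    using uniform_limitD[OF second_quotient_uniform_limit[OF h(1,2,3) t c]] by blast
  then have "\<forall>\<^sub>F n in sequentially. \<forall>l. \<forall>v\<in>cball 0 (norm w + \<delta>). dist (second_quotient (h l) x d (t n) v)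
      (c l + blinfun_apply (gateaux_deriv (h l) x) v) < \<eta>"
    by (rule eventually_all_finite)
  then obtain n where n: "N n" and close: "\<And>l v. norm v \<le> norm w + \<delta> \<Longrightarrow>
      \<bar>second_quotient (h l) x d (t n) v - (c l + blinfun_apply (gateaux_deriv (h l) x) v)\<bar> < \<eta>"
    using eventually_happens'[OF _ eventually_conj[OF N]] by (fastforce simp: dist_real_def)
  define \<Phi> where "\<Phi> z = (\<chi> l. second_quotient (h l) x d (t n) (w + E z))" for z
  have W_E: "W (w + E z)" if "norm z \<le> \<epsilon>" for z
    using \<epsilon>\<delta>[OF that] \<delta> by (simp add: dist_norm)
  have "\<exists>z\<in>cball 0 \<epsilon>. z - \<Phi> z = z"
  proof (rule brouwer)
    show "continuous_on (cball 0 \<epsilon>) (\<lambda>z. z - \<Phi> z)"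
    proof (intro continuous_on_diff continuous_on_id)
      have hD: "continuous_on D (h l)" for l
        using C11_on_imp_isCont[OF h(1,2)] continuous_at_imp_continuous_on by blast
      have arc: "continuous_on (cball 0 \<epsilon>) (\<lambda>z. arc n (w + E z))"
        unfolding arc_def E_def by (intro continuous_intros)
      have "continuous_on (cball 0 \<epsilon>) (\<lambda>z. h l (arc n (w + E z)))" for l
        by (rule continuous_on_compose2[OF hD arc]) (use NW[OF n] W_E in auto)
      then show "continuous_on (cball 0 \<epsilon>) \<Phi>"
        unfolding \<Phi>_def second_quotient_def arc_def using t(1)[of n]
        by (intro continuous_on_vec_lambda continuous_on_divide continuous_on_diff continuous_on_const) auto
    qed
    show "(\<lambda>z. z - \<Phi> z) \<in> cball 0 \<epsilon> \<rightarrow> cball 0 \<epsilon>"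
    proof
      fix z :: "real ^ 'p" assume z: "z \<in> cball 0 \<epsilon>"
      have "norm (w + E z) \<le> norm w + \<delta>" using norm_triangle_ineq[of w "E z"] \<epsilon>\<delta>[of z] z by simp
      note close' = close[OF this]
      have "\<bar>(z - \<Phi> z) $ l\<bar> \<le> \<eta>" for l
        using close'[of l] w[of l] by (simp add: \<Phi>_def blinfun.add_right hE abs_minus_commute add.assoc[symmetric])
      then have "(\<Sum>l\<in>UNIV. \<bar>(z - \<Phi> z) $ l\<bar>) \<le> (\<Sum>l\<in>(UNIV::'p set). \<eta>)" by (rule sum_mono)
      then have "norm (z - \<Phi> z) \<le> (\<Sum>l\<in>(UNIV::'p set). \<eta>)" using norm_le_l1_cart order_trans by blast
      then show "z - \<Phi> z \<in> cball 0 \<epsilon>" by (simp add: \<eta>_def)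
    qed
  qed (use \<epsilon> in auto)
  then obtain z where z: "norm z \<le> \<epsilon>" "\<Phi> z = 0" by auto
  have "h l (arc n (w + E z)) = 0" for l
  proof -
    have "second_quotient (h l) x d (t n) (w + E z) = 0" using z(2) by (simp add: \<Phi>_def vec_eq_iff)
    then show ?thesis using second_quotient_eq[of "t n" "h l" x d "w + E z"] t(1)[of n] zero
      by (simp add: arc_def)
  qed
  then show ?thesis using NW[OF n W_E[OF z(1)]] unfolding arc_def by blast
qed

section \<open>Linear functionals and a theorem of the alternative\<close>

text \<open>
  The functionals together map onto \<open>\<real>\<^sup>p\<close>, or else some nonzero \<open>\<beta>\<close> is orthogonal to the range.
\<close>
lemma biorthogonal_or_dependent:
  fixes A :: "'p::finite \<Rightarrow> 'a::real_normed_vector \<Rightarrow>\<^sub>L real"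
  shows "(\<exists>e. \<forall>l q. blinfun_apply (A l) (e q) = (if l = q then 1 else 0)) \<or>
    (\<exists>\<beta>::real ^ 'p. \<beta> \<noteq> 0 \<and> (\<Sum>l\<in>UNIV. \<beta> $ l *\<^sub>R A l) = 0)"
proof -
  define T :: "'a \<Rightarrow> real ^ 'p" where "T w = (\<chi> l. blinfun_apply (A l) w)" for w
  have "linear T"
    by (rule linearI) (simp_all add: T_def vec_eq_iff blinfun.add_right blinfun.scaleR_right)
  then have span: "span (range T) = range T"
    using linear_subspace_image subspace_UNIV span_eq_iff by blast
  show ?thesis
  proof (cases "range T = UNIV")
    case True
    then have "\<forall>q. \<exists>v. T v = axis q 1" by (metis surjD)
    then obtain e where "\<And>q. T (e q) = axis q 1" by metis
    then have "blinfun_apply (A l) (e q) = (if l = q then 1 else 0)" for l q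
      unfolding T_def axis_def vec_eq_iff by simp
    then show ?thesis by blast
  next
    case False
    then obtain \<beta> where \<beta>: "\<beta> \<noteq> 0" "\<And>y. y \<in> range T \<Longrightarrow> \<beta> \<bullet> y = 0"
      using span_not_UNIV_orthogonal[of "range T"] span by auto
    have "(\<Sum>l\<in>UNIV. \<beta> $ l *\<^sub>R A l) = 0"
      by (rule blinfun_eqI)
         (use \<beta>(2)[OF rangeI] in \<open>simp add: T_def inner_vec_def blinfun.sum_left blinfun.scaleR_left\<close>)
    then show ?thesis using \<beta> by blast
  qed
qed

lemma affine_nonneg_imp_slope_nonneg:
  fixes k m :: real
  assumes "\<And>s. s \<ge> 0 \<Longrightarrow> 0 \<le> k + s * m"
  shows "0 \<le> m"
proof (rule ccontr)
  assume "\<not> 0 \<le> m"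
  define s where "s = (\<bar>k\<bar> + 1) / - m"
  have "0 \<le> s" using \<open>\<not> 0 \<le> m\<close> unfolding s_def by (intro divide_nonneg_pos) auto
  moreover have "s * m = - (\<bar>k\<bar> + 1)" using \<open>\<not> 0 \<le> m\<close> unfolding s_def by (simp add: field_simps)
  ultimately show False using assms[of s] by linarith
qed

lemma affine_nonneg_imp_constant_nonneg:
  fixes k m :: real
  assumes "\<And>s. s > 0 \<Longrightarrow> 0 \<le> k + s * m"
  shows "0 \<le> k"
proof (rule tendsto_lowerbound)
  have "((\<lambda>s. k + s * m) \<longlongrightarrow> k + 0 * m) (at_right 0)" by (intro tendsto_intros)
  then show "((\<lambda>s. k + s * m) \<longlongrightarrow> k) (at_right 0)" by simp
  show "\<forall>\<^sub>F s in at_right 0. 0 \<le> k + s * m"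
    using assms by (auto intro: eventually_mono[OF eventually_at_right_less])
qed simp

text \<open>
  A Motzkin-type alternative. The set \<open>S\<close> of all vectors that lie strictly above the values of the
  inequalities in the components from \<open>J\<close> and \<open>I\<close>, and agree with the values of the equations, is
  convex and misses the origin, so a hyperplane separates them. Components outside \<open>J\<close> and \<open>I\<close> are
  left unrestricted in \<open>S\<close>, which forces their multipliers to vanish and so yields complementarity.
\<close>
lemma affine_system_alternative:
  fixes A :: "'m::finite \<Rightarrow> 'a::real_normed_vector \<Rightarrow>\<^sub>L real"
    and B :: "'k::finite \<Rightarrow> 'a \<Rightarrow>\<^sub>L real"
    and C :: "'p::finite \<Rightarrow> 'a \<Rightarrow>\<^sub>L real"
    and a :: "'m \<Rightarrow> real" and b :: "'k \<Rightarrow> real" and c :: "'p \<Rightarrow> real"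
  assumes inconsistent: "\<nexists>w. (\<forall>j\<in>J. a j + blinfun_apply (A j) w < 0) \<and>
    (\<forall>i\<in>I. b i + blinfun_apply (B i) w < 0) \<and> (\<forall>l. c l + blinfun_apply (C l) w = 0)"
  obtains \<mu> :: "real ^ 'm" and \<nu> :: "real ^ 'k" and \<beta> :: "real ^ 'p"
  where "(\<mu>, \<nu>, \<beta>) \<noteq> 0" "\<And>j. \<mu> $ j \<ge> 0" "\<And>i. \<nu> $ i \<ge> 0"
    "\<And>j. j \<notin> J \<Longrightarrow> \<mu> $ j = 0" "\<And>i. i \<notin> I \<Longrightarrow> \<nu> $ i = 0"
    "(\<Sum>j\<in>UNIV. \<mu> $ j *\<^sub>R A j) + (\<Sum>i\<in>UNIV. \<nu> $ i *\<^sub>R B i) + (\<Sum>l\<in>UNIV. \<beta> $ l *\<^sub>R C l) = 0"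
    "(\<Sum>j\<in>UNIV. \<mu> $ j * a j) + (\<Sum>i\<in>UNIV. \<nu> $ i * b i) + (\<Sum>l\<in>UNIV. \<beta> $ l * c l) \<ge> 0"
proof -
  define al where "al w = (\<chi> j. a j + blinfun_apply (A j) w)" for w
  define be where "be w = (\<chi> i. b i + blinfun_apply (B i) w)" for w
  define ga where "ga w = (\<chi> l. c l + blinfun_apply (C l) w)" for w
  define S where "S = {(y, z, u). \<exists>w. (\<forall>j\<in>J. al w $ j < y $ j) \<and> (\<forall>i\<in>I. be w $ i < z $ i) \<and> u = ga w}"
  have comb: "al (s *\<^sub>R w + r *\<^sub>R w') = s *\<^sub>R al w + r *\<^sub>R al w'"
      "be (s *\<^sub>R w + r *\<^sub>R w') = s *\<^sub>R be w + r *\<^sub>R be w'"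
      "ga (s *\<^sub>R w + r *\<^sub>R w') = s *\<^sub>R ga w + r *\<^sub>R ga w'" if "s + r = 1" for s r w w'
  proof -
    have "s * k + r * k = k" for k :: real using that by (metis distrib_right mult_1)
    then show "al (s *\<^sub>R w + r *\<^sub>R w') = s *\<^sub>R al w + r *\<^sub>R al w'"
      "be (s *\<^sub>R w + r *\<^sub>R w') = s *\<^sub>R be w + r *\<^sub>R be w'"
      "ga (s *\<^sub>R w + r *\<^sub>R w') = s *\<^sub>R ga w + r *\<^sub>R ga w'"
      by (simp_all add: al_def be_def ga_def vec_eq_iff blinfun.add_right blinfun.scaleR_right
          distrib_left add.assoc add.left_commute) (metis add.assoc add.commute)+
  qed
  have strict: "s * p + r * p' < s * q + r * q'" if "0 \<le> s" "0 \<le> r" "s + r = 1" "p < q" "p' < q'"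
    for s r p q p' q' :: real
  proof (cases "s = 0")
    case False
    then have "s * p < s * q" "r * p' \<le> r * q'" using that by (auto intro: mult_left_mono)
    then show ?thesis by linarith
  qed (use that in simp)
  have "convex S"
  proof (rule convexI)
    fix p q :: "(real ^ 'm) \<times> (real ^ 'k) \<times> (real ^ 'p)" and s r :: real
    assume pq: "p \<in> S" "q \<in> S" and sr: "0 \<le> s" "0 \<le> r" "s + r = 1"
    obtain y z u y' z' u' where p: "p = (y, z, u)" and q: "q = (y', z', u')"
      by (metis prod_cases3)
    obtain w where w: "\<forall>j\<in>J. al w $ j < y $ j" "\<forall>i\<in>I. be w $ i < z $ i" "u = ga w"
      using pq(1) unfolding S_def p by auto
    obtain w' where w': "\<forall>j\<in>J. al w' $ j < y' $ j" "\<forall>i\<in>I. be w' $ i < z' $ i" "u' = ga w'"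
      using pq(2) unfolding S_def q by auto
    show "s *\<^sub>R p + r *\<^sub>R q \<in> S"
      unfolding S_def p q using w w' sr
      by (auto simp: comb[OF sr(3)] intro!: exI[of _ "s *\<^sub>R w + r *\<^sub>R w'"] strict)
  qed
  moreover have "0 \<notin> S"
  proof
    assume "0 \<in> S"
    then obtain w where w: "\<forall>j\<in>J. al w $ j < 0" "\<forall>i\<in>I. be w $ i < 0" "0 = ga w"
      unfolding S_def zero_prod_def by auto
    from w(3) have "\<forall>l. ga w $ l = 0" by (metis zero_index)
    with w(1,2) have "(\<forall>j\<in>J. a j + blinfun_apply (A j) w < 0) \<and>
      (\<forall>i\<in>I. b i + blinfun_apply (B i) w < 0) \<and> (\<forall>l. c l + blinfun_apply (C l) w = 0)"
      by (simp add: al_def be_def ga_def)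
    then show False using inconsistent by blast
  qed
  ultimately obtain m where m: "m \<noteq> 0" "\<forall>p\<in>S. 0 \<le> m \<bullet> p"
    using separating_hyperplane_set_0 by blast
  obtain \<mu> \<nu> \<beta> where m_eq: "m = (\<mu>, \<nu>, \<beta>)" by (metis prod_cases3)
  have key: "0 \<le> \<mu> \<bullet> y + \<nu> \<bullet> z + \<beta> \<bullet> ga w"
    if "\<And>j. j \<in> J \<Longrightarrow> al w $ j < y $ j" "\<And>i. i \<in> I \<Longrightarrow> be w $ i < z $ i" for y z w
  proof -
    have "(y, z, ga w) \<in> S" using that unfolding S_def by blast
    then have "0 \<le> m \<bullet> (y, z, ga w)" using m(2) by blast
    then show ?thesis by (simp add: m_eq)
  qed
  let ?y = "al 0 + 1" and ?z = "be 0 + 1"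
  define k where "k = \<mu> \<bullet> ?y + \<nu> \<bullet> ?z + \<beta> \<bullet> ga 0"
  have mu: "0 \<le> k + s * \<mu> $ j" if "s \<ge> 0 \<or> j \<notin> J" for s j
  proof -
    have "0 \<le> \<mu> \<bullet> (?y + s *\<^sub>R axis j 1) + \<nu> \<bullet> ?z + \<beta> \<bullet> ga 0"
      by (rule key) (use that in \<open>auto simp: axis_def\<close>)
    then show ?thesis by (simp add: k_def inner_right_distrib inner_axis algebra_simps)
  qed
  have nu: "0 \<le> k + s * \<nu> $ i" if "s \<ge> 0 \<or> i \<notin> I" for s i
  proof -
    have "0 \<le> \<mu> \<bullet> ?y + \<nu> \<bullet> (?z + s *\<^sub>R axis i 1) + \<beta> \<bullet> ga 0"
      by (rule key) (use that in \<open>auto simp: axis_def\<close>)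
    then show ?thesis by (simp add: k_def inner_right_distrib inner_axis algebra_simps)
  qed
  have mu0: "\<mu> $ j \<ge> 0" for j
    by (rule affine_nonneg_imp_slope_nonneg[of k]) (use mu in blast)
  have nu0: "\<nu> $ i \<ge> 0" for i
    by (rule affine_nonneg_imp_slope_nonneg[of k]) (use nu in blast)
  have mu1: "\<mu> $ j = 0" if "j \<notin> J" for j
    using mu[of "- s" j for s] that mu0[of j] affine_nonneg_imp_slope_nonneg[of k "- \<mu> $ j"] by auto
  have nu1: "\<nu> $ i = 0" if "i \<notin> I" for i
    using nu[of "- s" i for s] that nu0[of i] affine_nonneg_imp_slope_nonneg[of k "- \<nu> $ i"] by auto
  \<comment> \<open>The strict inequalities in \<open>S\<close> have slack \<open>s\<close>, which tends to 0.\<close>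
  have weak: "0 \<le> \<mu> \<bullet> al w + \<nu> \<bullet> be w + \<beta> \<bullet> ga w" for w
  proof (rule affine_nonneg_imp_constant_nonneg)
    fix s :: real assume "s > 0"
    then have "0 \<le> \<mu> \<bullet> (al w + s *\<^sub>R 1) + \<nu> \<bullet> (be w + s *\<^sub>R 1) + \<beta> \<bullet> ga w"
      by (intro key) auto
    then show "0 \<le> \<mu> \<bullet> al w + \<nu> \<bullet> be w + \<beta> \<bullet> ga w + s * (\<mu> \<bullet> 1 + \<nu> \<bullet> 1)"
      by (simp add: inner_right_distrib algebra_simps)
  qed
  define V where "V = (\<Sum>j\<in>UNIV. \<mu> $ j * a j) + (\<Sum>i\<in>UNIV. \<nu> $ i * b i) + (\<Sum>l\<in>UNIV. \<beta> $ l * c l)"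
  define T where "T = (\<Sum>j\<in>UNIV. \<mu> $ j *\<^sub>R A j) + (\<Sum>i\<in>UNIV. \<nu> $ i *\<^sub>R B i) + (\<Sum>l\<in>UNIV. \<beta> $ l *\<^sub>R C l)"
  have VT: "0 \<le> V + blinfun_apply T w" for w
    using weak[of w]
    by (simp add: V_def T_def al_def be_def ga_def inner_vec_def distrib_left sum.distrib
        blinfun.add_left blinfun.sum_left blinfun.scaleR_left)
  have V: "0 \<le> V" using VT[of 0] by simp
  have "blinfun_apply T w \<ge> 0" for w
  proof (rule affine_nonneg_imp_slope_nonneg[of V])
    fix s show "0 \<le> V + s * blinfun_apply T w" using VT[of "s *\<^sub>R w"] by (simp add: blinfun.scaleR_right)
  qed
  then have T_nonneg: "blinfun_apply T w \<ge> 0" "- blinfun_apply T w \<ge> 0" for w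
    by (simp_all flip: blinfun.minus_right)
  have "T = 0"
    by (rule blinfun_eqI) (use T_nonneg in \<open>simp add: order_antisym\<close>)
  then show ?thesis using that[OF _ mu0 nu0 mu1 nu1] m(1) V unfolding m_eq V_def T_def by blast
qed

section \<open>Second-order necessary conditions for weak Pareto efficiency\<close>

lemma gateaux_deriv_vec_lambda:
  fixes h :: "'p::finite \<Rightarrow> 'a::real_normed_vector \<Rightarrow> real"
  assumes "\<And>l. \<exists>L. has_gateaux_derivative (h l) L x"
  shows "blinfun_apply (gateaux_deriv (\<lambda>x. \<chi> l. h l x) x) d = (\<chi> l. blinfun_apply (gateaux_deriv (h l) x) d)"
proof -
  have comp: "has_gateaux_derivative (h l) (gateaux_deriv (h l) x) x" for l
    using assms gateaux_deriv_eqI by metis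
  define T :: "'a \<Rightarrow> real ^ 'p" where "T v = (\<chi> l. blinfun_apply (gateaux_deriv (h l) x) v)" for v
  have bound: "\<bar>blinfun_apply (gateaux_deriv (h l) x) v\<bar> \<le> norm v * norm (gateaux_deriv (h l) x)" for l v
    using norm_blinfun[of "gateaux_deriv (h l) x" v] by (simp add: mult.commute)
  have "bounded_linear T"
    unfolding T_def
    by (rule bounded_linear_intro[where K = "\<Sum>l\<in>UNIV. norm (gateaux_deriv (h l) x)"])
       (auto simp: vec_eq_iff blinfun.add_right blinfun.scaleR_right sum_distrib_left mult.commute
         intro!: order_trans[OF norm_le_l1_cart] sum_mono bound)
  then have T: "blinfun_apply (Blinfun T) = T" by (rule bounded_linear_Blinfun_apply)
  have "has_gateaux_derivative (\<lambda>x. \<chi> l. h l x) (Blinfun T) x"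
    unfolding has_gateaux_derivative_def T
    by (intro allI vec_tendstoI) (use comp in \<open>simp add: T_def has_gateaux_derivative_def\<close>)
  then show ?thesis using gateaux_deriv_eqI T T_def by metis
qed

theorem corollary3p6:
  fixes D :: "'a::banach set"
    and f :: "'m::finite \<Rightarrow> 'a \<Rightarrow> real"
    and g :: "'k::finite \<Rightarrow> 'a \<Rightarrow> real"
    and h :: "'p::finite \<Rightarrow> 'a \<Rightarrow> real"
    and F :: "'a \<Rightarrow> real ^ 'm"
    and G :: "'a \<Rightarrow> real ^ 'k"
    and H :: "'a \<Rightarrow> real ^ 'p"
    and Q :: "(real ^ 'k) set"
    and xh d :: 'a
  assumes dual_ball:
      "seq_compactin weak_star_topology (cball (0 :: 'a \<Rightarrow>\<^sub>L real) 1)"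
    and D: "open D" "D \<noteq> {}"
    and C11_f: "\<And>j. C11_on D (f j)"
    and C11_g: "\<And>i. C11_on D (g i)"
    and C11_h: "\<And>l. C11_on D (h l)"
    and F: "F = (\<lambda>x. \<chi> j. f j x)"
    and G: "G = (\<lambda>x. \<chi> i. g i x)"
    and H: "H = (\<lambda>x. \<chi> l. h l x)"
    and Q: "Q = uminus ` nonneg_orthant"
    and efficient: "weak_pareto_efficient D F G Q H xh"
    and critical: "critical_direction F G Q H xh d"
  shows "\<exists>(\<mu> :: real ^ 'm) (lam :: real ^ 'k) (\<beta> :: real ^ 'p)
           (L :: 'm \<Rightarrow> 'a \<Rightarrow>\<^sub>L real) (M :: 'k \<Rightarrow> 'a \<Rightarrow>\<^sub>L real) (K :: 'p \<Rightarrow> 'a \<Rightarrow>\<^sub>L real).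
      (\<mu>, lam, \<beta>) \<in> (nonneg_orthant \<times> nonneg_orthant \<times> UNIV) - {0} \<and>
      (\<forall>j. L j \<in> subdiff2 (f j) xh d) \<and>
      (\<forall>i. M i \<in> subdiff2 (g i) xh d) \<and>
      (\<forall>l. K l \<in> subdiff2 (h l) xh d) \<and>
      (\<forall>i. lam $ i * g i xh = 0) \<and>
      (\<Sum>j\<in>UNIV. \<mu> $ j *\<^sub>R gateaux_deriv (f j) xh)
        + (\<Sum>i\<in>UNIV. lam $ i *\<^sub>R gateaux_deriv (g i) xh)
        + (\<Sum>l\<in>UNIV. \<beta> $ l *\<^sub>R gateaux_deriv (h l) xh) = 0 \<and>
      (\<Sum>j\<in>UNIV. \<mu> $ j * blinfun_apply (L j) d)
        + (\<Sum>i\<in>UNIV. lam $ i * blinfun_apply (M i) d)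
        + (\<Sum>l\<in>UNIV. \<beta> $ l * blinfun_apply (K l) d) \<ge> 0"
  proof -
  let ?gr = gateaux_deriv
  have xh: "xh \<in> D" and h0: "\<And>l. h l xh = 0" and g_le: "\<And>i. g i xh \<le> 0"
    and nobetter: "\<And>x. x \<in> D \<Longrightarrow> \<forall>l. h l x = 0 \<Longrightarrow> \<forall>i. g i x \<le> 0 \<Longrightarrow> \<exists>j. \<not> f j x < f j xh"
  proof -
    have Q_iff: "y \<in> Q \<longleftrightarrow> (\<forall>i. y $ i \<le> 0)" for y
      unfolding Q nonneg_orthant_def by (auto simp: image_iff intro!: exI[of _ "- y"])
    show "xh \<in> D" "\<And>l. h l xh = 0" "\<And>i. g i xh \<le> 0"
      using efficient unfolding weak_pareto_efficient_def Q_iff by (auto simp: F G H vec_eq_iff)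
    show "\<And>x. x \<in> D \<Longrightarrow> \<forall>l. h l x = 0 \<Longrightarrow> \<forall>i. g i x \<le> 0 \<Longrightarrow> \<exists>j. \<not> f j x < f j xh"
      using efficient unfolding weak_pareto_efficient_def Q_iff by (auto simp: F G H vec_eq_iff)
  qed
  have differentiable: "\<exists>L. has_gateaux_derivative \<phi> L xh" if "C11_on D \<phi>" for \<phi>
    using that xh unfolding C11_on_def by blast
  have fd: "blinfun_apply (?gr (f j) xh) d \<le> 0" for j
    using critical unfolding critical_direction_def by (simp add: F)
  have hd: "blinfun_apply (?gr (h l) xh) d = 0" for l
    using critical gateaux_deriv_vec_lambda[of h xh d, OF differentiable[OF C11_h]]
    unfolding critical_direction_def by (simp add: H vec_eq_iff)
  have gd: "blinfun_apply (?gr (g i) xh) d \<le> 0" if "g i xh = 0" for i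
  proof -
    have "closure (pos_cone ((\<lambda>q. q - G xh) ` Q)) \<subseteq> {y. y $ i \<le> 0}"
      by (rule closure_minimal)
        (auto simp: pos_cone_def Q nonneg_orthant_def G that mult_nonneg_nonneg intro: closed_halfspace_component_le_cart)
    then show ?thesis
      using critical gateaux_deriv_vec_lambda[of g xh d, OF differentiable[OF C11_g]]
      unfolding critical_direction_def by (auto simp: G)
  qed
  obtain t where t: "\<And>n. t n > 0" "t \<longlonglongrightarrow> 0" and "\<forall>\<phi>\<in>range f \<union> range g \<union> range h. \<exists>L\<in>subdiff2 \<phi> xh d.
      (\<lambda>n. second_quotient \<phi> xh d (t n) 0) \<longlonglongrightarrow> blinfun_apply L d"
  proof -
    define s where "s n = inverse (real (Suc n))" for n
    have s: "\<And>n. s n > 0" "s \<longlonglongrightarrow> 0"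
      unfolding s_def using LIMSEQ_inverse_real_of_nat by auto
    have finite: "finite (range f \<union> range g \<union> range h)" by simp
    have all: "C11_on D \<phi>" if "\<phi> \<in> range f \<union> range g \<union> range h" for \<phi>
      using that C11_f C11_g C11_h by auto
    obtain r where r: "strict_mono r" "\<forall>\<phi>\<in>range f \<union> range g \<union> range h. \<exists>L\<in>subdiff2 \<phi> xh d.
      (\<lambda>n. second_quotient \<phi> xh d (s (r n)) 0) \<longlonglongrightarrow> blinfun_apply L d"
      using second_quotient_common_subsequence[OF dual_ball D(1) xh s finite all, of d] by blast
    show ?thesis
      by (rule that[of "\<lambda>n. s (r n)"])
        (use r s LIMSEQ_subseq_LIMSEQ[OF s(2) r(1)] in \<open>auto simp: o_def\<close>)
  qed
  then have "\<forall>j. \<exists>L\<in>subdiff2 (f j) xh d. (\<lambda>n. second_quotient (f j) xh d (t n) 0) \<longlonglongrightarrow> blinfun_apply L d"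
    "\<forall>i. \<exists>L\<in>subdiff2 (g i) xh d. (\<lambda>n. second_quotient (g i) xh d (t n) 0) \<longlonglongrightarrow> blinfun_apply L d"
    "\<forall>l. \<exists>L\<in>subdiff2 (h l) xh d. (\<lambda>n. second_quotient (h l) xh d (t n) 0) \<longlonglongrightarrow> blinfun_apply L d"
    by auto
  then obtain L M K
    where L: "\<And>j. L j \<in> subdiff2 (f j) xh d" "\<And>j. (\<lambda>n. second_quotient (f j) xh d (t n) 0) \<longlonglongrightarrow> blinfun_apply (L j) d"
      and M: "\<And>i. M i \<in> subdiff2 (g i) xh d" "\<And>i. (\<lambda>n. second_quotient (g i) xh d (t n) 0) \<longlonglongrightarrow> blinfun_apply (M i) d"
      and K: "\<And>l. K l \<in> subdiff2 (h l) xh d" "\<And>l. (\<lambda>n. second_quotient (h l) xh d (t n) 0) \<longlonglongrightarrow> blinfun_apply (K l) d"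
    by metis
  have "\<exists>(\<mu> :: real ^ 'm) (\<nu> :: real ^ 'k) (\<beta> :: real ^ 'p). (\<mu>, \<nu>, \<beta>) \<noteq> 0 \<and>
      (\<forall>j. \<mu> $ j \<ge> 0) \<and> (\<forall>i. \<nu> $ i \<ge> 0) \<and> (\<forall>i. \<nu> $ i * g i xh = 0) \<and>
      (\<Sum>j\<in>UNIV. \<mu> $ j *\<^sub>R ?gr (f j) xh) + (\<Sum>i\<in>UNIV. \<nu> $ i *\<^sub>R ?gr (g i) xh)
        + (\<Sum>l\<in>UNIV. \<beta> $ l *\<^sub>R ?gr (h l) xh) = 0 \<and>
      (\<Sum>j\<in>UNIV. \<mu> $ j * blinfun_apply (L j) d) + (\<Sum>i\<in>UNIV. \<nu> $ i * blinfun_apply (M i) d)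
        + (\<Sum>l\<in>UNIV. \<beta> $ l * blinfun_apply (K l) d) \<ge> 0"
  proof (cases "\<exists>e. \<forall>l q. blinfun_apply (?gr (h l) xh) (e q) = (if l = q then 1 else 0)")
    case False
    then obtain \<beta> :: "real ^ 'p" where \<beta>: "\<beta> \<noteq> 0" "(\<Sum>l\<in>UNIV. \<beta> $ l *\<^sub>R ?gr (h l) xh) = 0"
      using biorthogonal_or_dependent[of "\<lambda>l. ?gr (h l) xh"] by blast
    \<comment> \<open>The functionals \<open>K l\<close> are fixed before the sign of \<open>\<beta>\<close>, so one of the two signs gives the inequality.\<close>
    define \<sigma> :: real where "\<sigma> = (if (\<Sum>l\<in>UNIV. \<beta> $ l * blinfun_apply (K l) d) \<ge> 0 then 1 else - 1)"
    have "(\<Sum>l\<in>UNIV. (\<sigma> *\<^sub>R \<beta>) $ l *\<^sub>R ?gr (h l) xh) = 0"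
      using \<beta>(2) by (simp flip: scaleR_scaleR scaleR_sum_right)
    moreover have "(\<Sum>l\<in>UNIV. (\<sigma> *\<^sub>R \<beta>) $ l * blinfun_apply (K l) d) \<ge> 0"
      by (simp add: \<sigma>_def sum_negf)
    ultimately show ?thesis
      using \<beta>(1) by (intro exI[of _ 0] exI[of _ "\<sigma> *\<^sub>R \<beta>"]) (simp add: \<sigma>_def zero_prod_def)
  next
    case True
    then obtain e where e: "\<And>l q. blinfun_apply (?gr (h l) xh) (e q) = (if l = q then 1 else 0)" by blast
    define J where "J = {j. blinfun_apply (?gr (f j) xh) d = 0}"
    \<comment> \<open>A constraint outside \<open>I\<close> holds along the arc for large \<open>n\<close>, whatever \<open>w\<close> is.\<close>
    define I where "I = {i. g i xh = 0 \<and> blinfun_apply (?gr (g i) xh) d = 0}"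
    have inconsistent: "\<nexists>w. (\<forall>j\<in>J. blinfun_apply (L j) d + blinfun_apply (?gr (f j) xh) w < 0) \<and>
        (\<forall>i\<in>I. blinfun_apply (M i) d + blinfun_apply (?gr (g i) xh) w < 0) \<and>
        (\<forall>l. blinfun_apply (K l) d + blinfun_apply (?gr (h l) xh) w = 0)"
    proof
      assume "\<exists>w. (\<forall>j\<in>J. blinfun_apply (L j) d + blinfun_apply (?gr (f j) xh) w < 0) \<and>
        (\<forall>i\<in>I. blinfun_apply (M i) d + blinfun_apply (?gr (g i) xh) w < 0) \<and>
        (\<forall>l. blinfun_apply (K l) d + blinfun_apply (?gr (h l) xh) w = 0)"
      then obtain w where wf: "\<And>j. j \<in> J \<Longrightarrow> blinfun_apply (L j) d + blinfun_apply (?gr (f j) xh) w < 0"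
        and wg: "\<And>i. i \<in> I \<Longrightarrow> blinfun_apply (M i) d + blinfun_apply (?gr (g i) xh) w < 0"
        and wh: "\<And>l. blinfun_apply (K l) d + blinfun_apply (?gr (h l) xh) w = 0"
        by blast
      let ?F = "sequentially \<times>\<^sub>F nhds w"
      let ?arc = "\<lambda>p. xh + t (fst p) *\<^sub>R d + ((t (fst p))\<^sup>2 / 2) *\<^sub>R snd p"
      note arc = tendsto_second_order_arc[OF t(2), of xh d w]
      have "\<forall>\<^sub>F p in ?F. ?arc p \<in> D" by (rule topological_tendstoD[OF arc D(1) xh])
      moreover have "\<forall>\<^sub>F p in ?F. \<forall>j. f j (?arc p) < f j xh"
        by (intro eventually_all_finite descent_along_second_order_arc[OF D(1) C11_f xh t L(2) fd])
          (use wf in \<open>simp add: J_def\<close>)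
      moreover have "\<forall>\<^sub>F p in ?F. \<forall>i. g i (?arc p) \<le> 0"
      proof (rule eventually_all_finite)
        fix i
        have "\<forall>\<^sub>F p in ?F. g i (?arc p) < 0"
        proof (cases "g i xh = 0")
          case True
          have "\<forall>\<^sub>F p in ?F. g i (?arc p) < g i xh"
            by (rule descent_along_second_order_arc[OF D(1) C11_g xh t M(2) gd[OF True]])
              (use wg True in \<open>simp add: I_def\<close>)
          then show ?thesis by (simp add: True)
        next
          case False
          then have "g i xh < 0" using g_le[of i] by simp
          moreover have "((\<lambda>p. g i (?arc p)) \<longlongrightarrow> g i xh) ?F"
            by (rule isCont_tendsto_compose[OF C11_on_imp_isCont[OF D(1) C11_g xh] arc])
          ultimately show ?thesis by (intro order_tendstoD(2))
        qed
        then show "\<forall>\<^sub>F p in ?F. g i (?arc p) \<le> 0" by eventually_elim simp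
      qed
      ultimately have "\<forall>\<^sub>F p in ?F. ?arc p \<in> D \<and> (\<forall>j. f j (?arc p) < f j xh) \<and> (\<forall>i. g i (?arc p) \<le> 0)"
        by eventually_elim blast
      from equality_constraints_along_second_order_arc[OF D(1) C11_h xh t K(2) e h0 hd wh this]
      obtain x where "x \<in> D" "\<forall>j. f j x < f j xh" "\<forall>i. g i x \<le> 0" "\<forall>l. h l x = 0"
        by auto
      then show False using nobetter by blast
    qed
    obtain \<mu> :: "real ^ 'm" and \<nu> :: "real ^ 'k" and \<beta> :: "real ^ 'p"
      where mult: "(\<mu>, \<nu>, \<beta>) \<noteq> 0" "\<And>j. \<mu> $ j \<ge> 0" "\<And>i. \<nu> $ i \<ge> 0" "\<And>i. i \<notin> I \<Longrightarrow> \<nu> $ i = 0"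
      "(\<Sum>j\<in>UNIV. \<mu> $ j *\<^sub>R ?gr (f j) xh) + (\<Sum>i\<in>UNIV. \<nu> $ i *\<^sub>R ?gr (g i) xh)
        + (\<Sum>l\<in>UNIV. \<beta> $ l *\<^sub>R ?gr (h l) xh) = 0"
      "(\<Sum>j\<in>UNIV. \<mu> $ j * blinfun_apply (L j) d) + (\<Sum>i\<in>UNIV. \<nu> $ i * blinfun_apply (M i) d)
        + (\<Sum>l\<in>UNIV. \<beta> $ l * blinfun_apply (K l) d) \<ge> 0"
      by (rule affine_system_alternative[OF inconsistent]) (rule that)
    have "\<nu> $ i * g i xh = 0" for i
      using mult(4)[of i] by (cases "i \<in> I") (auto simp: I_def)
    then show ?thesis
      by (intro exI[of _ \<mu>] exI[of _ \<nu>] exI[of _ \<beta>] conjI allI mult)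
  qed
  then obtain \<mu> :: "real ^ 'm" and \<nu> :: "real ^ 'k" and \<beta> :: "real ^ 'p"
    where mult: "(\<mu>, \<nu>, \<beta>) \<noteq> 0" "\<forall>j. \<mu> $ j \<ge> 0" "\<forall>i. \<nu> $ i \<ge> 0" "\<forall>i. \<nu> $ i * g i xh = 0"
      "(\<Sum>j\<in>UNIV. \<mu> $ j *\<^sub>R ?gr (f j) xh) + (\<Sum>i\<in>UNIV. \<nu> $ i *\<^sub>R ?gr (g i) xh)
        + (\<Sum>l\<in>UNIV. \<beta> $ l *\<^sub>R ?gr (h l) xh) = 0"
      "(\<Sum>j\<in>UNIV. \<mu> $ j * blinfun_apply (L j) d) + (\<Sum>i\<in>UNIV. \<nu> $ i * blinfun_apply (M i) d)
        + (\<Sum>l\<in>UNIV. \<beta> $ l * blinfun_apply (K l) d) \<ge> 0"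
    by blast
  have "(\<mu>, \<nu>, \<beta>) \<in> (nonneg_orthant \<times> nonneg_orthant \<times> UNIV) - {0}"
    using mult(1-3) by (simp add: nonneg_orthant_def)
  then show ?thesis
    by (intro exI[of _ \<mu>] exI[of _ \<nu>] exI[of _ \<beta>] exI[of _ L] exI[of _ M] exI[of _ K] conjI)
      (use mult(4-6) L(1) M(1) K(1) in auto)
qed

end
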